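(* Consider the average closed-loop dynamics of the ESC system under gradient saturation, $$\dot{\hat G}_{\mathrm{av}}(t)=HK\hat G_{\mathrm{av}}(t)-H\psi(K\hat G_{\mathrm{av}}(t))$$ (equivalently, in the time scale $\tau=\omega t$, $\frac{d}{d\tau}\hat G_{\mathrm{av}}=\frac1\omega HK\hat G_{\mathrm{av}}-\frac1\omega H\psi(K\hat G_{\mathrm{av}})$), under Assumptions 2 and 3 of the context. Let $\eta>0$ and $\epsilon>0$ be given scalars. If there exist a symmetric positive definite matrix $W\in\mathbb{R}^{n\times n}$, a diagonal positive definite matrix $\widetilde\Upsilon\in\mathbb{R}^{n\times n}$, and matrices $X,Y,Z\in\mathbb{R}^{n\times n}$ such that $$\begin{bmatrix} H_iZ+Z^\top H_i+2\eta W&\star&\star\\ W-X^\top+\epsilon H_iZ&-\epsilon(X^\top+X)&\star\\ Y-\widetilde\Upsilon H_i&-\epsilon\widetilde\Upsilon H_i&-2\widetilde\Upsilon\end{bmatrix}<0,\quad i=1,\dots,N,$$ and $$\begin{bmatrix}W&Z_{(\ell)}^\top-Y_{(\ell)}^\top\\ \star&\overline u_\ell^2\end{bmatrix}\ge0,\quad \ell=1,\dots,n,$$ then the origin of the average closed-loop system with $K=ZX^{-1}$ is exponentially stable and the region $$\mathcal{E}=\{\hat G_{\mathrm{av}}\in\mathbb{R}^n: V(\hat G_{\mathrm{av}})\le1\}$$ is a subset of $$\mathcal{G}=\{\hat G_{\mathrm{av}}\in\mathbb{R}^n: |(K-L)_{(\ell)}\hat G_{\mathrm{av}}|\le\overline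 u_\ell,\ \ell=1,\dots,n\},\qquad L=YX^{-1},$$ where $V(\hat G_{\mathrm{av}})=\hat G_{\mathrm{av}}^\top P\hat G_{\mathrm{av}}$, with $P=X^{-\top}WX^{-1}$, is a Lyapunov function that certifies the exponential stability of the origin. Thus, any trajectory $\hat G_{\mathrm{av}}(t)$ with initial condition $\hat G_{\mathrm{av}}(0)\in\mathcal{E}$ satisfies $$\|\hat G_{\mathrm{av}}(t)\|\le\kappa_ge^{-\eta t}\|\hat G_{\mathrm{av}}(0)\|,\qquad \kappa_g=\sqrt{\lambda_{\max}(P)/\lambda_{\min}(P)}.$$
   Context: Notation: for symmetric matrices, $X>0$ ($X<0$) means positive (negative) definite; $\star$ denotes blocks determined by symmetry; $X_{(\ell)}$ is the $\ell$-th row of $X$; $X^{-\top}=(X^{-1})^\top$; $\lambda_{\max},\lambda_{\min}$ are the extreme eigenvalues. Saturation: $\mathrm{sat}:\mathbb{R}^n\to\mathbb{R}^n$ acts element-wise, $\mathrm{sat}(v)_\ell=\mathrm{sign}(v_\ell)\min(|v_\ell|,\overline u_\ell)$ with bounds $\overline u_\ell>0$. Dead-zone: $\psi(v)=v-\mathrm{sat}(v)$. Underlying ESC system: $\theta(t)=\hat\theta(t)+S(t)$, $y(t)=Q^*+\frac12(\theta(t)-\theta^* )^\top H(\theta(t)-\theta^* )$, $\hat G(t)=M(t)y(t)$, $\dot{\hat\theta}(t)=\mathrm{sat}(K\hat G(t))$, with unknown $Q^*\in\mathbb{R}$, $\theta^*\in\mathbb{R}^n$ and symmetric Hessian $H\in\mathbb{R}^{n\times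 n}$, and $S(t)=[a_1\sin(\omega_1t)\ \cdots\ a_n\sin(\omega_nt)]^\top$, $M(t)=[\frac{2}{a_1}\sin(\omega_1t)\ \cdots\ \frac{2}{a_n}\sin(\omega_nt)]^\top$, $a_i\ne0$. Its average gradient-estimate dynamics is the autonomous system displayed in the claim. Assumption 2: for a given $\omega>0$, $\omega_i=\omega_i'\omega$ with $\omega_i'$ rational and $\omega_i'\notin\{\omega_j',\ \tfrac12(\omega_j'+\omega_k'),\ \omega_j'+2\omega_k',\ \omega_k'\pm\omega_l'\}$ for all distinct $i,j,k,l\in\{1,\dots,n\}$. Assumption 3: $H\in\mathrm{co}\{H_1,\dots,H_N\}$, the convex hull of known symmetric matrices $H_i$; i.e. $H=\sum_{i=1}^N\alpha_iH_i$ with unknown fixed $\alpha_i\ge0$, $\sum_i\alpha_i=1$. *)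

theory Defs
  imports "HOL-Analysis.Analysis"
begin

section \<open>Definite matrices, extreme eigenvalues, block matrices\<close>

definition pos_def :: "real^'n^'n \<Rightarrow> bool" where
  "pos_def A \<longleftrightarrow> transpose A = A \<and> (\<forall>x. x \<noteq> 0 \<longrightarrow> x \<bullet> (A *v x) > 0)"

definition neg_def :: "real^'n^'n \<Rightarrow> bool" where
  "neg_def A \<longleftrightarrow> transpose A = A \<and> (\<forall>x. x \<noteq> 0 \<longrightarrow> x \<bullet> (A *v x) < 0)"

definition pos_semidef :: "real^'n^'n \<Rightarrow> bool" where
  "pos_semidef A \<longleftrightarrow> transpose A = A \<and> (\<forall>x. x \<bullet> (A *v x) \<ge> 0)"

definition diagonal_matrix :: "real^'n^'n \<Rightarrow> bool" where
  "diagonal_matrix A \<longleftrightarrow> (\<forall>i j. i \<noteq> j \<longrightarrow> A $ i $ j = 0)"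

definition eigenvalues :: "real^'n^'n \<Rightarrow> real set" where
  "eigenvalues A = {c. \<exists>v. v \<noteq> 0 \<and> A *v v = c *\<^sub>R v}"

text \<open>Only used for symmetric matrices, whose set of real eigenvalues is finite and nonempty.\<close>

definition lambda_max :: "real^'n^'n \<Rightarrow> real" where
  "lambda_max A = Max (eigenvalues A)"

definition lambda_min :: "real^'n^'n \<Rightarrow> real" where
  "lambda_min A = Min (eigenvalues A)"

definition vcat :: "real^'k^'n \<Rightarrow> real^'k^'m \<Rightarrow> real^'k^('n + 'm)" where
  "vcat A B = (\<chi> i j. case i of Inl i' \<Rightarrow> A $ i' $ j | Inr i' \<Rightarrow> B $ i' $ j)"

text \<open>The block matrix with first row \<open>A, transpose B\<close> and second row \<open>B, D\<close>.\<close>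

definition sym_block2 ::
    "real^'n^'n \<Rightarrow> real^'n^'m \<Rightarrow> real^'m^'m \<Rightarrow> real^('n + 'm)^('n + 'm)" where
  "sym_block2 A B D = (\<chi> i j. case i of
      Inl i' \<Rightarrow> (case j of Inl j' \<Rightarrow> A $ i' $ j' | Inr j' \<Rightarrow> B $ j' $ i')
    | Inr i' \<Rightarrow> (case j of Inl j' \<Rightarrow> B $ i' $ j' | Inr j' \<Rightarrow> D $ i' $ j'))"

text \<open>The \<open>3 \<times> 3\<close> symmetric block matrix, given by its lower triangle row by row.\<close>

definition sym_block3 ::
    "real^'n^'n \<Rightarrow> real^'n^'m \<Rightarrow> real^'m^'m \<Rightarrow> real^'n^'p \<Rightarrow> real^'m^'p \<Rightarrow> real^'p^'p
      \<Rightarrow> real^('n + 'm + 'p)^('n + 'm + 'p)" where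
  "sym_block3 A11 A21 A22 A31 A32 A33 =
     sym_block2 A11 (vcat A21 A31) (sym_block2 A22 A32 A33)"

section \<open>Solutions, exponential stability, Lyapunov functions\<close>

definition solves_on :: "(real^'n \<Rightarrow> real^'n) \<Rightarrow> real set \<Rightarrow> (real \<Rightarrow> real^'n) \<Rightarrow> bool" where
  "solves_on f J x \<longleftrightarrow> (\<forall>t\<in>J. (x has_vector_derivative f (x t)) (at t within J))"

text \<open>A forward trajectory may be given on any time interval starting at \<open>0\<close>, bounded or not;
  the estimates below are thus required of local and of global solutions alike.\<close>

definition trajectory_on :: "(real^'n \<Rightarrow> real^'n) \<Rightarrow> real set \<Rightarrow> (real \<Rightarrow> real^'n) \<Rightarrow> bool" where
  "trajectory_on f J x \<longleftrightarrow> is_interval J \<and> 0 \<in> J \<and> J \<subseteq> {0..} \<and> solves_on f J x"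

definition origin_exp_stable :: "(real^'n \<Rightarrow> real^'n) \<Rightarrow> bool" where
  "origin_exp_stable f \<longleftrightarrow> f 0 = 0 \<and>
     (\<exists>c>0. \<exists>k>0. \<exists>r>0. \<forall>J x. trajectory_on f J x \<and> norm (x 0) < c \<longrightarrow>
        (\<forall>t\<in>J. norm (x t) \<le> k * exp (- r * t) * norm (x 0)))"

text \<open>The hypotheses of Lyapunov's theorem on exponential stability, on a neighbourhood \<open>D\<close> of
  the origin: \<open>V\<close> is continuously differentiable, comparable with a power of the norm, and its
  derivative along the vector field \<open>f\<close> is bounded by a negative multiple of that power.\<close>

definition exp_lyapunov_on ::
    "(real^'n \<Rightarrow> real^'n) \<Rightarrow> (real^'n) set \<Rightarrow> (real^'n \<Rightarrow> real) \<Rightarrow> bool" where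
  "exp_lyapunov_on f D V \<longleftrightarrow> 0 \<in> interior D \<and>
     (\<exists>grad. continuous_on D grad \<and>
        (\<forall>x\<in>D. (V has_derivative (\<lambda>h. grad x \<bullet> h)) (at x)) \<and>
        (\<exists>p>0. \<exists>k1>0. \<exists>k2>0. \<exists>k3>0. \<forall>x\<in>D.
           k1 * norm x powr p \<le> V x \<and> V x \<le> k2 * norm x powr p \<and>
           grad x \<bullet> f x \<le> - k3 * norm x powr p))"

section \<open>The saturated extremum seeking loop\<close>

definition sat :: "real^'n \<Rightarrow> real^'n \<Rightarrow> real^'n" where
  "sat ubar v = (\<chi> l. sgn (v $ l) * min \<bar>v $ l\<bar> (ubar $ l))"

definition dead_zone :: "real^'n \<Rightarrow> real^'n \<Rightarrow> real^'n" where
  "dead_zone ubar v = v - sat ubar v"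

definition avg_field ::
    "real^'n^'n \<Rightarrow> real^'n^'n \<Rightarrow> real^'n \<Rightarrow> real^'n \<Rightarrow> real^'n" where
  "avg_field H K ubar g = (H ** K) *v g - H *v dead_zone ubar (K *v g)"

text \<open>Condition on the dither frequencies \<open>freq i = freq' i * \<omega>\<close>. Each exclusion is required for
  all pairwise distinct indices occurring in it, so that it is also meaningful for fewer than
  four indices.\<close>

definition admissible_frequencies :: "real \<Rightarrow> ('n::finite \<Rightarrow> real) \<Rightarrow> bool" where
  "admissible_frequencies \<omega> freq \<longleftrightarrow> \<omega> > 0 \<and>
     (\<exists>freq'. (\<forall>i. freq i = freq' i * \<omega> \<and> freq' i \<in> \<rat>) \<and>
        (\<forall>i j. i \<noteq> j \<longrightarrow> freq' i \<noteq> freq' j) \<and>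
        (\<forall>i j k. i \<noteq> j \<and> i \<noteq> k \<and> j \<noteq> k \<longrightarrow>
           freq' i \<noteq> (freq' j + freq' k) / 2 \<and>
           freq' i \<noteq> freq' j + 2 * freq' k \<and>
           freq' i \<noteq> freq' j + freq' k \<and>
           freq' i \<noteq> freq' j - freq' k))"

text \<open>The linear matrix inequalities, for one vertex matrix \<open>H\<close> and for one index \<open>l\<close>.\<close>

definition vertex_lmi ::
    "real \<Rightarrow> real \<Rightarrow> real^'n^'n \<Rightarrow> real^'n^'n \<Rightarrow> real^'n^'n \<Rightarrow> real^'n^'n \<Rightarrow> real^'n^'n
      \<Rightarrow> real^'n^'n \<Rightarrow> bool" where
  "vertex_lmi \<eta> \<epsilon> W U X Y Z H \<longleftrightarrow> neg_def (sym_block3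
     (H ** Z + transpose Z ** H + (2 * \<eta>) *\<^sub>R W)
     (W - transpose X + \<epsilon> *\<^sub>R (H ** Z))  (- \<epsilon> *\<^sub>R (transpose X + X))
     (Y - U ** H)                        (- \<epsilon> *\<^sub>R (U ** H))         (- 2 *\<^sub>R U))"

definition row_lmi ::
    "real^'n \<Rightarrow> real^'n^'n \<Rightarrow> real^'n^'n \<Rightarrow> real^'n^'n \<Rightarrow> 'n \<Rightarrow> bool" where
  "row_lmi ubar W Y Z l \<longleftrightarrow> pos_semidef (sym_block2
     W
     (rowvector (row l Z - row l Y) :: real^'n^1)  (mat ((ubar $ l)\<^sup>2)))"

end

theory Submission
  imports Defs
begin

text \<open>The matrix inequality is affine in the vertex matrix, so it holds for \<open>H\<close> itself; its middle
  block makes \<open>X\<close> invertible. Evaluated at \<open>(X\<inverse> g, X\<inverse> g', U\<inverse> \<psi>)\<close> with \<open>g' = H K g - H \<psi>\<close>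
  and \<open>\<psi>\<close> the dead zone of \<open>K g\<close>, its quadratic form collapses to
  \<open>V' + 2 \<eta> V + 2 (U\<inverse> \<psi>) \<bullet> (L g - \<psi>)\<close>. The row inequalities, minimised over the scalar component,
  say that \<open>\<E> \<subseteq> \<G>\<close>, and on \<open>\<G>\<close> the last term is nonnegative by the sector property of the dead
  zone. Hence \<open>V' \<le> - 2 \<eta> V\<close> on \<open>\<E>\<close>, which makes \<open>\<E>\<close> forward invariant and gives the decay.\<close>

section \<open>Symmetric matrices\<close>

lemma inner_symmetric_matrix:
  fixes A :: "real^'n^'n"
  assumes "transpose A = A"
  shows "x \<bullet> (A *v y) = (A *v x) \<bullet> y"
  by (metis assms dot_lmul_matrix transpose_matrix_vector)

lemma matrix_vector_mult_minus_left:
  fixes A :: "real^'n^'m"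
  shows "- A *v x = - (A *v x)"
  by (metis diff_0 matrix_vector_mult_0 matrix_vector_mult_diff_rdistrib)

lemma scaleR_matrix_vector_mult:
  fixes A :: "real^'n^'m"
  shows "(r *\<^sub>R A) *v x = r *\<^sub>R (A *v x)"
  by (simp add: scaleR_matrix_vector_assoc)

lemma matrix_inv_left_right:
  fixes A :: "real^'n^'n"
  assumes "invertible A"
  shows "A ** matrix_inv A = mat 1" "matrix_inv A ** A = mat 1"
  using someI_ex[OF assms[unfolded invertible_def]] by (simp_all add: matrix_inv_def)

text \<open>At \<open>v\<close> the form attains its minimum 0, so its first variation in the
  direction \<open>w = B *v v\<close>, which is \<open>2 * (w \<bullet> w)\<close>, must
  vanish.\<close>

lemma quadratic_form_zero_imp_kernel:
  fixes B :: "real^'n^'n"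
  assumes sym: "transpose B = B" and nonneg: "\<And>x. x \<bullet> (B *v x) \<ge> 0" and "v \<bullet> (B *v v) = 0"
  shows "B *v v = 0"
proof (rule ccontr)
  define w where "w = B *v v"
  assume "B *v v \<noteq> 0"
  then have pos: "w \<bullet> w > 0"
    by (simp add: w_def)
  define q where "q = w \<bullet> (B *v w)"
  have q: "q \<ge> 0"
    using nonneg by (simp add: q_def)
  have ge: "2 * t * (w \<bullet> w) + t\<^sup>2 * q \<ge> 0" for t
  proof -
    have "v \<bullet> (B *v w) = w \<bullet> w"
      using inner_symmetric_matrix[OF sym, of v w] by (simp add: w_def)
    moreover have "w \<bullet> (B *v v) = w \<bullet> w"
      by (simp add: w_def)
    ultimately have "(v + t *\<^sub>R w) \<bullet> (B *v (v + t *\<^sub>R w)) = 2 * t * (w \<bullet> w) + t\<^sup>2 * q"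
      using assms(3)
      by (simp add: matrix_vector_right_distrib matrix_vector_mult_scaleR inner_add_left
          inner_add_right q_def power2_eq_square algebra_simps)
    then show ?thesis
      using nonneg by metis
  qed
  \<comment> \<open>A negative \<open>t\<close> for which the linear term wins. The denominator
    \<open>1 + q\<close> also covers \<open>q = 0\<close> and gives
    \<open>2 * (w \<bullet> w) + t * q = w \<bullet> w - t > 0\<close>.\<close>
  define t where "t = - (w \<bullet> w) / (1 + q)"
  have t: "t * (1 + q) = - (w \<bullet> w)" "t < 0"
    using q pos by (auto simp: t_def divide_neg_pos)
  have "t * (2 * (w \<bullet> w) + t * q) \<ge> 0"
    using ge[of t] by (simp add: algebra_simps power2_eq_square)
  moreover have "2 * (w \<bullet> w) + t * q > 0"
  proof -
    have "t * q = - (w \<bullet> w) - t"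
      using t(1) by (simp add: distrib_left)
    then show ?thesis
      using t(2) pos by linarith
  qed
  ultimately show False
    using \<open>t < 0\<close> by (simp add: zero_le_mult_iff)
qed

text \<open>A maximiser \<open>v\<close> of the form on the compact unit sphere is an eigenvector:
  with \<open>m\<close> the maximum, \<open>m I - A\<close> is positive semidefinite and its form
  vanishes at \<open>v\<close>, so \<open>v\<close> lies in its kernel.\<close>

lemma rayleigh_max:
  fixes A :: "real^'n^'n"
  assumes sym: "transpose A = A"
  obtains m where "m \<in> eigenvalues A" "\<And>x. x \<bullet> (A *v x) \<le> m * (x \<bullet> x)"
proof -
  let ?q = "\<lambda>x. x \<bullet> (A *v x)"
  have "continuous_on (sphere 0 1) ?q"
    by (intro continuous_intros matrix_vector_mult_linear_continuous_on)
  \<comment> \<open>The sphere is nonempty: every coordinate unit vector lies on it, so the index is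
    left arbitrary.\<close>
  moreover have "axis undefined 1 \<in> sphere (0::real^'n) 1"
    by simp
  ultimately obtain v where v: "norm v = 1" and max: "\<And>x. norm x = 1 \<Longrightarrow> ?q x \<le> ?q v"
    using continuous_attains_sup[of "sphere (0::real^'n) 1" ?q] by (auto simp: dist_norm)
  have le: "?q x \<le> ?q v * (x \<bullet> x)" for x
  proof (cases "x = 0")
    case False
    have "?q (x /\<^sub>R norm x) \<le> ?q v"
      using False by (intro max) simp
    moreover have "?q (x /\<^sub>R norm x) = ?q x / (x \<bullet> x)"
      by (simp add: matrix_vector_mult_scaleR dot_square_norm power2_eq_square field_simps)
    ultimately show ?thesis
      using False by (simp add: divide_le_eq)
  qed auto
  define B where "B = ?q v *\<^sub>R mat 1 - A"
  have B: "B *v x = ?q v *\<^sub>R x - A *v x" for x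
    by (simp add: B_def matrix_vector_mult_diff_rdistrib flip: scaleR_matrix_vector_assoc)
  have "transpose B = B"
    using sym by (auto simp: B_def vec_eq_iff transpose_def mat_def)
  moreover have "x \<bullet> (B *v x) \<ge> 0" for x
    using le[of x] by (simp add: B inner_diff_right)
  moreover have "v \<bullet> (B *v v) = 0"
    using v by (simp add: B inner_diff_right dot_square_norm)
  ultimately have "B *v v = 0"
    by (rule quadratic_form_zero_imp_kernel)
  then have "?q v \<in> eigenvalues A"
    using v by (auto simp: B eigenvalues_def intro!: exI[of _ v])
  then show thesis
    using le that by blast
qed

lemma eigenvalues_uminus: "c \<in> eigenvalues (- A) \<longleftrightarrow> - c \<in> eigenvalues A"
proof -
  have "- A *v v = c *\<^sub>R v \<longleftrightarrow> A *v v = (- c) *\<^sub>R v" for v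
    by (metis add.inverse_inverse matrix_vector_mult_minus_left scaleR_minus_left)
  then show ?thesis
    by (simp add: eigenvalues_def)
qed

lemma rayleigh_min:
  fixes A :: "real^'n^'n"
  assumes "transpose A = A"
  obtains m where "m \<in> eigenvalues A" "\<And>x. x \<bullet> (A *v x) \<ge> m * (x \<bullet> x)"
proof -
  have "transpose (- A) = - A"
    using assms by (simp add: vec_eq_iff transpose_def)
  then obtain m where "m \<in> eigenvalues (- A)" and m: "\<And>x. x \<bullet> (- A *v x) \<le> m * (x \<bullet> x)"
    by (rule rayleigh_max) blast
  then have "- m \<in> eigenvalues A"
    by (simp add: eigenvalues_uminus)
  moreover have "x \<bullet> (A *v x) \<ge> (- m) * (x \<bullet> x)" for x
    using m[of x] by (simp add: matrix_vector_mult_minus_left)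
  ultimately show thesis
    by (rule that)
qed

text \<open>Pick one eigenvector per eigenvalue. By symmetry, those of distinct eigenvalues are
  orthogonal, so they form an independent and hence finite set. Finiteness is what makes
  \<open>Max\<close> and \<open>Min\<close> of the spectrum meaningful.\<close>

lemma finite_eigenvalues:
  fixes A :: "real^'n^'n"
  assumes sym: "transpose A = A"
  shows "finite (eigenvalues A)"
proof -
  define vec where "vec c = (SOME v. v \<noteq> 0 \<and> A *v v = c *\<^sub>R v)" for c
  have vec: "vec c \<noteq> 0" "A *v vec c = c *\<^sub>R vec c" if "c \<in> eigenvalues A" for c
    using that unfolding eigenvalues_def vec_def
    by (metis (mono_tags, lifting) mem_Collect_eq someI_ex)+
  have orth: "vec c \<bullet> vec d = 0" if "c \<in> eigenvalues A" "d \<in> eigenvalues A" "c \<noteq> d" for c d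
    using inner_symmetric_matrix[OF sym, of "vec c" "vec d"] vec that by simp
  have "inj_on vec (eigenvalues A)"
    using orth vec by (metis inj_onI inner_eq_zero_iff)
  moreover have "pairwise orthogonal (vec ` eigenvalues A)"
    using orth by (auto simp: pairwise_def orthogonal_def)
  then have "independent (vec ` eigenvalues A)"
    using vec by (intro pairwise_orthogonal_independent) auto
  then have "finite (vec ` eigenvalues A)"
    by (rule independent_imp_finite)
  ultimately show ?thesis
    using finite_imageD by blast
qed

text \<open>It is enough that some eigenvalue bounds the form on each side;
  \<open>lambda_min\<close> lies below the one and \<open>lambda_max\<close> above the
  other.\<close>

lemma rayleigh_bounds:
  fixes A :: "real^'n^'n"
  assumes sym: "transpose A = A"
  shows "lambda_min A * (norm x)\<^sup>2 \<le> x \<bullet> (A *v x)" "x \<bullet> (A *v x) \<le> lambda_max A * (norm x)\<^sup>2"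
proof -
  obtain m where "m \<in> eigenvalues A" and m: "\<And>x. x \<bullet> (A *v x) \<ge> m * (x \<bullet> x)"
    using rayleigh_min[OF sym] by blast
  then have "lambda_min A \<le> m"
    using finite_eigenvalues[OF sym] by (simp add: lambda_min_def)
  then show "lambda_min A * (norm x)\<^sup>2 \<le> x \<bullet> (A *v x)"
    using m[of x] by (smt (verit) dot_square_norm mult_right_mono zero_le_power2)
  obtain M where "M \<in> eigenvalues A" and M: "\<And>x. x \<bullet> (A *v x) \<le> M * (x \<bullet> x)"
    using rayleigh_max[OF sym] by blast
  then have "M \<le> lambda_max A"
    using finite_eigenvalues[OF sym] by (simp add: lambda_max_def)
  then show "x \<bullet> (A *v x) \<le> lambda_max A * (norm x)\<^sup>2"
    using M[of x] by (smt (verit) dot_square_norm mult_right_mono zero_le_power2)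
qed

lemma lambda_pos:
  fixes A :: "real^'n^'n"
  assumes "pos_def A"
  shows "lambda_min A > 0" "lambda_max A > 0"
proof -
  have sym: "transpose A = A"
    using assms by (simp add: pos_def_def)
  have "c > 0" if "c \<in> eigenvalues A" for c
  proof -
    from that obtain v where "v \<noteq> 0" "A *v v = c *\<^sub>R v"
      by (auto simp: eigenvalues_def)
    then have "c * (v \<bullet> v) > 0"
      using assms by (metis inner_scaleR_right pos_def_def)
    then show ?thesis
      by (meson inner_ge_zero not_less zero_less_mult_iff)
  qed
  moreover have "eigenvalues A \<noteq> {}"
    using rayleigh_max[OF sym] by blast
  ultimately show "lambda_min A > 0" "lambda_max A > 0"
    using finite_eigenvalues[OF sym] by (auto simp: lambda_min_def lambda_max_def Max_gr_iff)
qed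

lemma pos_def_congruence:
  fixes W S :: "real^'n^'n"
  assumes "pos_def W" "invertible S"
  shows "pos_def (transpose S ** W ** S)"
proof -
  have "transpose (transpose S ** W ** S) = transpose S ** W ** S"
    using assms(1) by (simp add: pos_def_def matrix_transpose_mul matrix_mul_assoc)
  moreover have "x \<bullet> ((transpose S ** W ** S) *v x) = (S *v x) \<bullet> (W *v (S *v x))" for x
    by (metis dot_lmul_matrix inner_commute matrix_vector_mul_assoc transpose_matrix_vector)
  moreover have "S *v x \<noteq> 0" if "x \<noteq> 0" for x
    using that assms(2) by (metis inj_matrix_vector_mult injD matrix_vector_mult_0_right)
  ultimately show ?thesis
    using assms(1) by (simp add: pos_def_def)
qed

section \<open>Block quadratic forms\<close>

definition vjoin :: "real^'n \<Rightarrow> real^'m \<Rightarrow> real^('n + 'm)" where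
  "vjoin a b = (\<chi> i. case i of Inl i' \<Rightarrow> a $ i' | Inr i' \<Rightarrow> b $ i')"

lemma vjoin_nth [simp]: "vjoin a b $ Inl i = a $ i" "vjoin a b $ Inr j = b $ j"
  by (simp_all add: vjoin_def)

lemma vjoin_eq_0_iff: "vjoin a b = 0 \<longleftrightarrow> a = 0 \<and> b = 0"
  by (auto simp: vec_eq_iff vjoin_def split: sum.splits)

lemma sum_UNIV_sum:
  fixes f :: "'n::finite + 'm::finite \<Rightarrow> 'a::comm_monoid_add"
  shows "sum f UNIV = (\<Sum>i\<in>UNIV. f (Inl i)) + (\<Sum>j\<in>UNIV. f (Inr j))"
  by (simp add: sum.Plus flip: UNIV_Plus_UNIV)

lemma vcat_mult: "vcat A B *v x = vjoin (A *v x) (B *v x)"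
  by (auto simp: vec_eq_iff vcat_def vjoin_def matrix_vector_mult_def split: sum.splits)

lemma inner_vjoin: "vjoin a b \<bullet> vjoin c d = a \<bullet> c + b \<bullet> d"
  by (simp add: inner_vec_def sum_UNIV_sum)

lemma sym_block2_mult:
  "sym_block2 A B D *v vjoin a b = vjoin (A *v a + b v* B) (B *v a + D *v b)"
  by (auto simp: vec_eq_iff sym_block2_def vjoin_def matrix_vector_mult_def
      vector_matrix_mult_def sum_UNIV_sum mult.commute split: sum.splits)

lemma sym_block2_form:
  "vjoin a b \<bullet> (sym_block2 A B D *v vjoin a b) =
    a \<bullet> (A *v a) + 2 * (b \<bullet> (B *v a)) + b \<bullet> (D *v b)"
  by (simp add: sym_block2_mult inner_vjoin inner_add_right inner_commute[of a "b v* B"]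
      dot_lmul_matrix)

lemma sym_block3_form:
  "vjoin a (vjoin b c) \<bullet> (sym_block3 A11 A21 A22 A31 A32 A33 *v vjoin a (vjoin b c)) =
    a \<bullet> (A11 *v a) + 2 * (b \<bullet> (A21 *v a)) + b \<bullet> (A22 *v b)
    + 2 * (c \<bullet> (A31 *v a)) + 2 * (c \<bullet> (A32 *v b)) + c \<bullet> (A33 *v c)"
  by (simp add: sym_block3_def sym_block2_form vcat_mult inner_vjoin)

text \<open>The quadratic form of the matrix in \<open>vertex_lmi\<close> at the block vector \<open>(a, b, c)\<close>.\<close>

definition lmi_form ::
    "real \<Rightarrow> real \<Rightarrow> real^'n^'n \<Rightarrow> real^'n^'n \<Rightarrow> real^'n^'n \<Rightarrow> real^'n^'n \<Rightarrow> real^'n^'n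
      \<Rightarrow> real^'n \<Rightarrow> real^'n \<Rightarrow> real^'n \<Rightarrow> real^'n^'n \<Rightarrow> real" where
  "lmi_form \<eta> \<epsilon> W U X Y Z a b c H =
     a \<bullet> (H *v (Z *v a)) + (Z *v a) \<bullet> (H *v a) + 2 * \<eta> * (a \<bullet> (W *v a))
     + 2 * (b \<bullet> (W *v a) - a \<bullet> (X *v b) + \<epsilon> * (b \<bullet> (H *v (Z *v a)))) - 2 * \<epsilon> * (b \<bullet> (X *v b))
     + 2 * (c \<bullet> (Y *v a) - c \<bullet> (U *v (H *v a))) - 2 * \<epsilon> * (c \<bullet> (U *v (H *v b)))
     - 2 * (c \<bullet> (U *v c))"

lemma vertex_lmi_form_neg:
  assumes "vertex_lmi \<eta> \<epsilon> W U X Y Z H" and "a \<noteq> 0 \<or> b \<noteq> 0 \<or> c \<noteq> 0"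
  shows "lmi_form \<eta> \<epsilon> W U X Y Z a b c H < 0"
proof -
  \<comment> \<open>Transposed blocks act as row vector products; this identity moves the matrix to
    the other factor, so that \<open>lmi_form\<close> contains no transpose.\<close>
  have T: "x \<bullet> (y v* M) = y \<bullet> (M *v x)" for x :: "real^'n" and y and M :: "real^'n^'n"
    by (metis dot_lmul_matrix inner_commute)
  let ?x = "vjoin a (vjoin b c)"
  let ?M = "sym_block3 (H ** Z + transpose Z ** H + (2 * \<eta>) *\<^sub>R W)
     (W - transpose X + \<epsilon> *\<^sub>R (H ** Z)) (- \<epsilon> *\<^sub>R (transpose X + X))
     (Y - U ** H) (- \<epsilon> *\<^sub>R (U ** H)) (- 2 *\<^sub>R U)"
  have "?x \<noteq> 0"
    using assms(2) by (simp add: vjoin_eq_0_iff)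
  then have "?x \<bullet> (?M *v ?x) < 0"
    using assms(1) by (simp add: vertex_lmi_def neg_def_def)
  moreover have "?x \<bullet> (?M *v ?x) = lmi_form \<eta> \<epsilon> W U X Y Z a b c H"
    unfolding lmi_form_def
    by (simp add: sym_block3_form T matrix_vector_mult_minus_left scaleR_matrix_vector_mult matrix_vector_mult_add_rdistrib
        matrix_vector_mult_diff_rdistrib inner_add_right inner_diff_right
        flip: matrix_vector_mul_assoc)
      (simp add: algebra_simps inner_commute)
  ultimately show ?thesis
    by simp
qed

text \<open>For fixed \<open>a\<close>, \<open>b\<close>, \<open>c\<close> the form is affine in
  \<open>H\<close>: the terms without \<open>H\<close> are reproduced because the weights sum to 1.
  This carries the inequality from the vertices to their convex hull.\<close>

lemma convex_lmi_form_neg: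
  fixes X :: "real^'n^'n"
  shows "convex {H. lmi_form \<eta> \<epsilon> W U X Y Z a b c H < 0}"
proof (rule convexI)
  fix H1 H2 :: "real^'n^'n" and u v :: real
  let ?F = "lmi_form \<eta> \<epsilon> W U X Y Z a b c"
  assume H: "H1 \<in> {H. ?F H < 0}" "H2 \<in> {H. ?F H < 0}" and uv: "0 \<le> u" "0 \<le> v" "u + v = 1"
  have v: "v = 1 - u"
    using uv by simp
  have "?F (u *\<^sub>R H1 + v *\<^sub>R H2) = u * ?F H1 + v * ?F H2"
    unfolding v lmi_form_def
    by (simp add: matrix_vector_mult_add_rdistrib matrix_vector_right_distrib
        matrix_vector_mult_scaleR inner_add_right flip: scaleR_matrix_vector_assoc)
      (simp add: algebra_simps)
  also have "\<dots> < 0"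
    using H convexD[OF convex_real_interval(4)[of 0] _ _ uv, of "?F H1" "?F H2"] by simp
  finally show "u *\<^sub>R H1 + v *\<^sub>R H2 \<in> {H. ?F H < 0}"
    by simp
qed

lemma convex_symmetric_matrices: "convex {H :: real^'n^'n. transpose H = H}"
  by (rule convexI) (simp add: vec_eq_iff transpose_def)

section \<open>The dead zone\<close>

text \<open>The dead zone vanishes for \<open>\<bar>v\<bar> \<le> u\<close>. Beyond the bound it is
  \<open>v - u\<close> or \<open>v + u\<close> and has the sign of \<open>v\<close>; as
  \<open>w\<close> is within \<open>u\<close> of \<open>v\<close>, the second factor has that sign
  too or is zero.\<close>

lemma sector_component:
  fixes v w u :: real
  assumes "u > 0" "\<bar>v - w\<bar> \<le> u"
  shows "(v - sgn v * min \<bar>v\<bar> u) * (w - (v - sgn v * min \<bar>v\<bar> u)) \<ge> 0"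
proof -
  consider "\<bar>v\<bar> \<le> u" | "v > u" | "v < - u"
    by linarith
  then show ?thesis
  proof cases
    case 1
    then show ?thesis
      by (simp add: sgn_mult_abs)
  next
    case 2
    then have "v - sgn v * min \<bar>v\<bar> u = v - u"
      using assms by simp
    then show ?thesis
      using 2 assms by simp
  next
    case 3
    then have "v - sgn v * min \<bar>v\<bar> u = v + u"
      using assms by simp
    then show ?thesis
      using 3 assms by (simp add: mult_nonpos_nonpos)
  qed
qed

text \<open>The positive weights \<open>1 / d l\<close> stand for the inverse of a diagonal
  multiplier: acting componentwise, they preserve the sign of each product.\<close>

lemma sector_condition:
  fixes ubar v w c :: "real^'n"
  assumes "\<And>l. ubar $ l > 0" "\<And>l. \<bar>v $ l - w $ l\<bar> \<le> ubar $ l" "\<And>l. d l > 0"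
    and "\<And>l. c $ l = dead_zone ubar v $ l / d l"
  shows "c \<bullet> (w - dead_zone ubar v) \<ge> 0"
proof -
  have "c $ l * (w - dead_zone ubar v) $ l \<ge> 0" for l
  proof -
    have "dead_zone ubar v $ l * (w - dead_zone ubar v) $ l \<ge> 0"
      using sector_component[OF assms(1)[of l] assms(2)[of l]] by (simp add: dead_zone_def sat_def)
    then show ?thesis
      using assms(3)[of l] by (simp add: assms(4))
  qed
  then show ?thesis
    by (simp add: inner_vec_def sum_nonneg)
qed

section \<open>Trajectories\<close>

text \<open>This is the chain rule for the inner map \<open>\<tau> / c\<close>, which sends the
  stretched time set back onto \<open>J\<close>.\<close>

lemma solves_on_rescale:
  assumes "c > 0" "solves_on F J g"
  shows "solves_on (\<lambda>x. (1 / c) *\<^sub>R F x) ((\<lambda>t. c * t) ` J) (\<lambda>\<tau>. g (\<tau> / c))"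
  unfolding solves_on_def
proof
  fix \<tau> assume "\<tau> \<in> (\<lambda>t. c * t) ` J"
  then obtain t where t: "t \<in> J" "\<tau> = c * t"
    by blast
  have img: "(\<lambda>\<tau>. \<tau> / c) ` (\<lambda>t. c * t) ` J = J"
    using assms(1) by (simp add: image_image)
  have "((\<lambda>\<tau>. \<tau> / c) has_vector_derivative 1 / c) (at \<tau> within (\<lambda>t. c * t) ` J)"
    using assms(1) by (auto intro!: derivative_eq_intros)
  moreover have "(g has_vector_derivative F (g (\<tau> / c)))
      (at (\<tau> / c) within (\<lambda>\<tau>. \<tau> / c) ` (\<lambda>t. c * t) ` J)"
    using assms t unfolding img solves_on_def by simp
  ultimately show "((\<lambda>\<tau>. g (\<tau> / c)) has_vector_derivative (1 / c) *\<^sub>R F (g (\<tau> / c)))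
      (at \<tau> within (\<lambda>t. c * t) ` J)"
    using vector_diff_chain_within by (fastforce simp: o_def)
qed

lemma solves_on_rescale_iff:
  assumes "c > 0"
  shows "solves_on (\<lambda>x. (1 / c) *\<^sub>R F x) ((\<lambda>t. c * t) ` J) (\<lambda>\<tau>. g (\<tau> / c)) \<longleftrightarrow> solves_on F J g"
  (is "?L \<longleftrightarrow> ?R")
proof
  \<comment> \<open>The converse is the same rescaling with factor \<open>1 / c\<close>.\<close>
  assume ?L
  with assms have "solves_on (\<lambda>x. (1 / (1 / c)) *\<^sub>R ((1 / c) *\<^sub>R F x))
      ((\<lambda>t. 1 / c * t) ` (\<lambda>t. c * t) ` J) (\<lambda>\<tau>. g (\<tau> / (1 / c) / c))"
    using solves_on_rescale[of "1 / c" "\<lambda>x. (1 / c) *\<^sub>R F x" "(\<lambda>t. c * t) ` J" "\<lambda>\<tau>. g (\<tau> / c)"]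
    by simp
  then show ?R
    using assms by (simp add: image_image)
qed (use assms in \<open>simp add: solves_on_rescale\<close>)

lemma has_derivative_quadratic_form:
  fixes P :: "real^'n^'n"
  assumes "transpose P = P"
  shows "((\<lambda>x. x \<bullet> (P *v x)) has_derivative (\<lambda>h. (2 *\<^sub>R (P *v x)) \<bullet> h)) (at x)"
proof -
  have "((\<lambda>x. P *v x) has_derivative (\<lambda>h. P *v h)) (at x)"
    by (rule bounded_linear_imp_has_derivative) simp
  then have "((\<lambda>x. x \<bullet> (P *v x)) has_derivative (\<lambda>h. x \<bullet> (P *v h) + h \<bullet> (P *v x))) (at x)"
    by (auto intro!: derivative_eq_intros)
  moreover have "x \<bullet> (P *v h) + h \<bullet> (P *v x) = (2 *\<^sub>R (P *v x)) \<bullet> h" for h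
    using inner_symmetric_matrix[OF assms, of x h] by (simp add: inner_commute)
  ultimately show ?thesis
    by simp
qed

text \<open>No trajectory leaves the unit sublevel set of \<open>V\<close>, because \<open>V\<close> strictly decreases
  immediately after the last time at which \<open>V \<le> 1\<close>.\<close>

lemma sublevel_decay:
  fixes v v' :: "real \<Rightarrow> real"
  assumes J: "is_interval J" "0 \<in> J" "J \<subseteq> {0..}"
    and deriv: "\<And>t. t \<in> J \<Longrightarrow> (v has_real_derivative v' t) (at t within J)"
    and decr: "\<And>t. t \<in> J \<Longrightarrow> v t \<le> 1 \<Longrightarrow> v' t \<le> - r * v t"
    and r: "r > 0" and init: "v 0 \<le> 1" and t: "t \<in> J"
  shows "v t \<le> exp (- r * t) * v 0"
proof -
  have sub: "{0..s} \<subseteq> J" if "s \<in> J" for s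
    using mem_is_interval_1_I[OF J(1,2) that] by auto
  have cont: "continuous_on {0..s} v" if "s \<in> J" for s
    using sub[OF that] deriv
    by (meson DERIV_continuous_on continuous_on_subset)
  have inside: "v s \<le> 1" if s: "s \<in> J" for s
  proof (rule ccontr)
    assume "\<not> v s \<le> 1"
    have s0: "s \<ge> 0"
      using s J by auto
    \<comment> \<open>By continuity these times form a compact set, so there is a last one,
      \<open>u\<close>.\<close>
    define T where "T = {u \<in> {0..s}. v u \<le> 1}"
    have "closed T"
      unfolding T_def using cont[OF s] continuous_closed_preimage[of "{0..s}" v "{..1}"]
      by (simp add: vimage_def Int_def)
    moreover have "bounded T"
      by (rule bounded_subset[of "{0..s}"]) (auto simp: T_def)
    ultimately have "compact T"
      by (simp add: compact_eq_bounded_closed)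
    moreover have "0 \<in> T"
      using init s0 by (simp add: T_def)
    ultimately obtain u where u: "u \<in> T" and last: "\<And>w. w \<in> T \<Longrightarrow> w \<le> u"
      using compact_attains_sup[of T] by blast
    then have "0 \<le> u" "u < s" "v u \<le> 1"
      using \<open>\<not> v s \<le> 1\<close> by (auto simp: T_def order_less_le)
    have "u \<in> J"
      using sub[OF s] u by (auto simp: T_def)
    \<comment> \<open>Otherwise the intermediate value theorem yields a later time with value 1.
      Knowing \<open>v u = 1\<close>, the decrease condition gives a strictly negative derivative at
      \<open>u\<close>.\<close>
    have "v u \<ge> 1"
    proof (rule ccontr)
      assume "\<not> v u \<ge> 1"
      then obtain w where "u \<le> w" "w \<le> s" "v w = 1"
        using IVT'[of v u 1 s] \<open>\<not> v s \<le> 1\<close> \<open>u < s\<close> cont[OF s] \<open>0 \<le> u\<close>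
        by (smt (verit) atLeastatMost_subset_iff continuous_on_subset)
      then have "w \<in> T" "w \<noteq> u"
        using \<open>0 \<le> u\<close> \<open>\<not> v u \<ge> 1\<close> by (auto simp: T_def)
      then show False
        using last \<open>u \<le> w\<close> by fastforce
    qed
    then have "v' u < 0"
      using decr[OF \<open>u \<in> J\<close> \<open>v u \<le> 1\<close>] r by (smt (verit) mult_minus_left mult_pos_pos)
    moreover have "(v has_real_derivative v' u) (at u within {0..s})"
      using deriv[OF \<open>u \<in> J\<close>] sub[OF s] by (rule DERIV_subset)
    ultimately obtain d where d: "d > 0"
      "\<And>h. h > 0 \<Longrightarrow> u + h \<in> {0..s} \<Longrightarrow> h < d \<Longrightarrow> v (u + h) < v u"
      using has_real_derivative_neg_dec_right by metis
    \<comment> \<open>Halving keeps \<open>h\<close> below \<open>d\<close>, and the cap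
      \<open>s - u\<close> keeps \<open>u + h\<close> inside \<open>{0..s}\<close>.\<close>
    define h where "h = min (d / 2) (s - u)"
    have "v (u + h) < v u"
      using d(1) \<open>u < s\<close> \<open>0 \<le> u\<close> by (intro d(2)) (auto simp: h_def)
    then have "u + h \<in> T"
      using \<open>u < s\<close> \<open>0 \<le> u\<close> \<open>v u \<le> 1\<close> d(1) by (auto simp: T_def h_def)
    then show False
      using last[of "u + h"] d(1) \<open>u < s\<close> by (auto simp: h_def)
  qed
  have t0: "t \<ge> 0"
    using t J by auto
  \<comment> \<open>Integrating factor: the derivative of \<open>e\<close> is nonpositive, since
    \<open>decr\<close> is available at every time once \<open>v\<close> is known to stay below
    1.\<close>
  define e where "e s = exp (r * s) * v s" for s
  have e: "(e has_real_derivative exp (r * s) * (r * v s + v' s)) (at s within {0..t})"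
    if "0 \<le> s" "s \<le> t" for s
  proof -
    have "(v has_real_derivative v' s) (at s within {0..t})"
      using deriv sub[OF t] that by (meson DERIV_subset atLeastAtMost_iff subsetD)
    then show ?thesis
      unfolding e_def[abs_def] by (auto intro!: derivative_eq_intros simp: algebra_simps)
  qed
  obtain s where s: "s \<in> {0..t}" "e t - e 0 = exp (r * s) * (r * v s + v' s) * (t - 0)"
    using mvt_very_simple[OF t0 e[unfolded has_field_derivative_def]] by blast
  then have "s \<in> J"
    using sub[OF t] by blast
  then have "r * v s + v' s \<le> 0"
    using decr inside by fastforce
  then have "exp (r * s) * (r * v s + v' s) * (t - 0) \<le> 0"
    using t0 by (intro mult_nonpos_nonneg mult_nonneg_nonpos) auto
  then have "e t \<le> e 0"
    using s by simp
  then show ?thesis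
    by (simp add: e_def exp_minus field_simps)
qed

section \<open>Exponential stability and the certified region for the saturated average
  system\<close>

theorem lemma4:
  fixes H K L P W U X Y Z :: "real^'n^'n"
    and Hs :: "nat \<Rightarrow> real^'n^'n" and N :: nat
    and ubar :: "real^'n" and \<omega> \<eta> \<epsilon> :: real and freq :: "'n \<Rightarrow> real"
    and V :: "real^'n \<Rightarrow> real" and \<E> \<G> :: "(real^'n) set"
  assumes "\<And>l. ubar $ l > 0"
    and "admissible_frequencies \<omega> freq"
    and "\<And>i. i \<in> {1..N} \<Longrightarrow> transpose (Hs i) = Hs i"
    and "H \<in> convex hull (Hs ` {1..N})"
    and "\<eta> > 0" and "\<epsilon> > 0"
    and "pos_def W"
    and "diagonal_matrix U" and "pos_def U"
    and "\<And>i. i \<in> {1..N} \<Longrightarrow> vertex_lmi \<eta> \<epsilon> W U X Y Z (Hs i)"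
    and "\<And>l. row_lmi ubar W Y Z l"
    and "K = Z ** matrix_inv X"
    and "L = Y ** matrix_inv X"
    and "P = transpose (matrix_inv X) ** W ** matrix_inv X"
    and "V = (\<lambda>g. g \<bullet> (P *v g))"
    and "\<E> = {g. V g \<le> 1}"
    and "\<G> = {g. \<forall>l. \<bar>row l (K - L) \<bullet> g\<bar> \<le> ubar $ l}"
  shows "invertible X
    \<and> (\<forall>J g. solves_on (avg_field H K ubar) J g \<longleftrightarrow>
           solves_on (\<lambda>x. (1 / \<omega>) *\<^sub>R ((H ** K) *v x) - (1 / \<omega>) *\<^sub>R (H *v dead_zone ubar (K *v x)))
             ((\<lambda>t. \<omega> * t) ` J) (\<lambda>\<tau>. g (\<tau> / \<omega>)))
    \<and> origin_exp_stable (avg_field H K ubar)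
    \<and> \<E> \<subseteq> \<G>
    \<and> exp_lyapunov_on (avg_field H K ubar) \<E> V
    \<and> (\<forall>J g. trajectory_on (avg_field H K ubar) J g \<and> g 0 \<in> \<E> \<longrightarrow>
           (\<forall>t\<in>J. norm (g t) \<le> sqrt (lambda_max P / lambda_min P) * exp (- \<eta> * t) * norm (g 0)))"
proof -
  let ?f = "avg_field H K ubar" and ?I = "matrix_inv X"
  note [simp] = \<open>V = _\<close>
  have u_pos: "ubar $ l > 0" for l
    by fact
  have H_sym: "transpose H = H"
  proof -
    have "Hs ` {1..N} \<subseteq> {H. transpose H = H}"
      using assms(3) by auto
    from hull_minimal[of _ _ convex, OF this convex_symmetric_matrices] show ?thesis
      using assms(4) by blast
  qed
  have form_neg: "lmi_form \<eta> \<epsilon> W U X Y Z a b c H < 0" if "a \<noteq> 0 \<or> b \<noteq> 0 \<or> c \<noteq> 0" for a b c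
  proof -
    have "Hs ` {1..N} \<subseteq> {H. lmi_form \<eta> \<epsilon> W U X Y Z a b c H < 0}"
      using assms(10) vertex_lmi_form_neg that by blast
    from hull_minimal[of _ _ convex, OF this convex_lmi_form_neg] show ?thesis
      using assms(4) by blast
  qed
  \<comment> \<open>At \<open>(0, x, 0)\<close> the only term that could survive is
    \<open>- 2 * \<epsilon> * (x \<bullet> (X *v x))\<close>; on the kernel of \<open>X\<close> it
    is 0, against strict negativity.\<close>
  have "x = 0" if "X *v x = 0" for x
    using form_neg[of 0 x 0] that by (auto simp: lmi_form_def)
  then have inv: "invertible X"
    by (simp add: invertible_left_inverse matrix_left_invertible_ker)
  then have X_inv: "X *v (?I *v g) = g" for g
    by (simp add: matrix_vector_mul_assoc matrix_inv_left_right)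
  have "invertible ?I"
    using inv by (metis invertible_def matrix_inv_left_right)
  then have P: "pos_def P"
    unfolding \<open>P = _\<close> by (intro pos_def_congruence \<open>pos_def W\<close>)
  then have P_sym: "transpose P = P"
    by (simp add: pos_def_def)
  have P_form: "x \<bullet> (P *v y) = (?I *v x) \<bullet> (W *v (?I *v y))" for x y
    unfolding \<open>P = _\<close>
    by (metis dot_lmul_matrix inner_commute matrix_vector_mul_assoc transpose_matrix_vector)

  have KL: "\<bar>(K *v g) $ l - (L *v g) $ l\<bar> \<le> ubar $ l" if "V g \<le> 1" for g l
  proof -
    define a where "a = ?I *v g"
    define d where "d = (Z *v a) $ l - (Y *v a) $ l"
    \<comment> \<open>the minimiser of the quadratic form of \<open>row_lmi\<close> in its last component\<close>
    define s where "s = - d / (ubar $ l)\<^sup>2"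
    let ?s = "(\<chi> i. s) :: real^1"
    have row: "rowvector (row l Z - row l Y) *v a = (\<chi> i. d)"
      by (simp add: vec_eq_iff d_def rowvector_def row_def matrix_vector_mult_def sum_subtractf
          left_diff_distrib)
    have mat: "mat ((ubar $ l)\<^sup>2) *v ?s = (\<chi> i. (ubar $ l)\<^sup>2 * s)"
      by (simp add: vec_eq_iff matrix_vector_mult_def mat_def sum_1)
    have "vjoin a ?s \<bullet> (sym_block2 W (rowvector (row l Z - row l Y)) (mat ((ubar $ l)\<^sup>2)) *v
        vjoin a ?s) \<ge> 0"
      using assms(11)[of l] by (simp add: row_lmi_def pos_semidef_def)
    then have "a \<bullet> (W *v a) + 2 * (s * d) + s * ((ubar $ l)\<^sup>2 * s) \<ge> 0"
      unfolding sym_block2_form row mat by (simp add: inner_vec_def[where 'b = 1] sum_1)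
    moreover have "a \<bullet> (W *v a) \<le> 1"
      using that by (simp add: P_form a_def)
    moreover have s: "(ubar $ l)\<^sup>2 * s = - d"
      using u_pos[of l] by (simp add: s_def)
    \<comment> \<open>By the choice of \<open>s\<close>, the terms \<open>2 * (s * d)\<close> and
      \<open>s * (- d)\<close> add up to \<open>s * d\<close>. Multiplying by the squared bound then
      turns this into \<open>d\<^sup>2 \<le> (ubar $ l)\<^sup>2\<close>.\<close>
    ultimately have "1 + s * d \<ge> 0"
      by (simp add: mult.commute)
    then have "(ubar $ l)\<^sup>2 * (1 + s * d) \<ge> 0"
      by (intro mult_nonneg_nonneg) auto
    moreover have "(ubar $ l)\<^sup>2 * (1 + s * d) = (ubar $ l)\<^sup>2 + (ubar $ l)\<^sup>2 * s * d"
      by (simp add: algebra_simps)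
    ultimately have "d\<^sup>2 \<le> (ubar $ l)\<^sup>2"
      unfolding s by (simp add: power2_eq_square)
    then have "\<bar>d\<bar> \<le> \<bar>ubar $ l\<bar>"
      by (simp only: abs_le_square_iff)
    then have "\<bar>d\<bar> \<le> ubar $ l"
      using u_pos[of l] by simp
    then show ?thesis
      by (simp add: d_def a_def assms(12,13) matrix_vector_mul_assoc)
  qed
  have E_G: "\<E> \<subseteq> \<G>"
  proof
    fix g assume "g \<in> \<E>"
    moreover have "row l (K - L) \<bullet> g = (K *v g) $ l - (L *v g) $ l" for l
      by (simp add: inner_vec_def row_def matrix_vector_mult_def sum_subtractf left_diff_distrib)
    ultimately show "g \<in> \<G>"
      using KL unfolding \<open>\<E> = _\<close> \<open>\<G> = _\<close> by simp
  qed

  have decrease: "(2 *\<^sub>R (P *v g)) \<bullet> ?f g \<le> - (2 * \<eta>) * V g" if "V g \<le> 1" for g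
  \<comment> \<open>The strict inequality needs a nonzero block vector, which \<open>a\<close>
    provides when \<open>g\<close> is nonzero; at the origin both sides vanish.\<close>
  proof (cases "g = 0")
    case False
    define \<psi> where "\<psi> = dead_zone ubar (K *v g)"
    define a where "a = ?I *v g"
    define b where "b = ?I *v ?f g"
    define c where "c = (\<chi> l. \<psi> $ l / U $ l $ l)"
    have U_pos: "U $ l $ l > 0" for l
    proof -
      have "axis l 1 \<bullet> (U *v axis l 1) > 0"
        using \<open>pos_def U\<close> unfolding pos_def_def by (metis axis_eq_0_iff zero_neq_one)
      then show ?thesis
        by (simp add: inner_axis' matrix_vector_mul_component inner_axis)
    qed
    have Uc: "U *v c = \<psi>"
    proof -
      have "(\<Sum>j\<in>UNIV. U $ i $ j * c $ j) = (\<Sum>j\<in>UNIV. if j = i then \<psi> $ i else 0)" for i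
        using \<open>diagonal_matrix U\<close> U_pos[of i]
        by (intro sum.cong) (auto simp: diagonal_matrix_def c_def)
      then show ?thesis
        by (simp add: vec_eq_iff matrix_vector_mult_def)
    qed
    have Za: "Z *v a = K *v g" and Ya: "Y *v a = L *v g"
      by (simp_all add: a_def assms(12,13) matrix_vector_mul_assoc)
    have Xb: "X *v b = H *v (K *v g) - H *v \<psi>"
      unfolding b_def X_inv by (simp add: avg_field_def \<psi>_def matrix_vector_mul_assoc)
    have U_sym: "c \<bullet> (U *v x) = \<psi> \<bullet> x" for x
      using inner_symmetric_matrix[of U c x] \<open>pos_def U\<close> by (simp add: pos_def_def Uc)
    have "c \<bullet> (L *v g - \<psi>) \<ge> 0"
      unfolding \<psi>_def using u_pos KL[OF that] U_pos
      by (rule sector_condition[where d = "\<lambda>l. U $ l $ l"]) (simp add: c_def \<psi>_def)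
    moreover have "a \<noteq> 0"
      using False X_inv[of g] by (auto simp: a_def)
    then have "lmi_form \<eta> \<epsilon> W U X Y Z a b c H < 0"
      by (intro form_neg) simp
    \<comment> \<open>All terms containing \<open>H\<close> or \<open>X\<close> combine to
      \<open>2 * ((a + \<epsilon> b) \<bullet> (H Z a - H U c - X b))\<close>, a multiplier times
      the residual of the dynamics. It vanishes because \<open>X b = H K g - H \<psi>\<close>,
      whatever \<open>\<epsilon>\<close> is.\<close>
    moreover have "lmi_form \<eta> \<epsilon> W U X Y Z a b c H =
        2 * \<eta> * (a \<bullet> (W *v a)) + 2 * (b \<bullet> (W *v a)) + 2 * (c \<bullet> (L *v g - \<psi>))"
    proof -
      have swap: "x \<bullet> (H *v y) = y \<bullet> (H *v x)" for x y
        using inner_symmetric_matrix[OF H_sym, of x y] by (simp add: inner_commute)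
      show ?thesis
        unfolding lmi_form_def U_sym Xb Za Ya inner_diff_right swap[of "K *v g" a]
          swap[of \<psi> a] swap[of \<psi> b] inner_commute[of \<psi> c]
        by algebra
    qed
    moreover have "V g = a \<bullet> (W *v a)" "(2 *\<^sub>R (P *v g)) \<bullet> ?f g = 2 * (b \<bullet> (W *v a))"
      by (simp_all add: P_form a_def b_def inner_commute[of "P *v g"])
    ultimately show ?thesis
      by simp
  qed simp

  let ?\<kappa> = "sqrt (lambda_max P / lambda_min P)"
  note lam = lambda_pos[OF P]
  have V_bounds: "lambda_min P * (norm x)\<^sup>2 \<le> V x" "V x \<le> lambda_max P * (norm x)\<^sup>2" for x
    using rayleigh_bounds[OF P_sym] by simp_all
  \<comment> \<open>\<open>V\<close> decays at rate \<open>2 * \<eta>\<close>. Comparing it with the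
    squared norm on both sides and taking square roots halves the rate and produces the condition
    factor.\<close>
  have bound: "norm (g t) \<le> ?\<kappa> * exp (- \<eta> * t) * norm (g 0)"
    if traj: "trajectory_on ?f J g" and "V (g 0) \<le> 1" and "t \<in> J" for J g t
  proof -
    have "V (g t) \<le> exp (- (2 * \<eta>) * t) * V (g 0)"
    proof (rule sublevel_decay)
      show "((\<lambda>t. V (g t)) has_real_derivative (2 *\<^sub>R (P *v g s)) \<bullet> ?f (g s)) (at s within J)"
        if "s \<in> J" for s
      proof -
        have "(g has_derivative (\<lambda>h. h *\<^sub>R ?f (g s))) (at s within J)"
          using traj that
          by (simp add: trajectory_on_def solves_on_def has_vector_derivative_def)
        from has_derivative_compose[OF this has_derivative_quadratic_form[OF P_sym]]
        have "((\<lambda>t. V (g t)) has_derivative (\<lambda>h. (2 *\<^sub>R (P *v g s)) \<bullet> (h *\<^sub>R ?f (g s))))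
            (at s within J)"
          by simp
        then show ?thesis
          unfolding has_field_derivative_def
          by (rule has_derivative_eq_rhs) (simp add: fun_eq_iff)
      qed
    qed (use traj that decrease \<open>\<eta> > 0\<close> in \<open>auto simp: trajectory_on_def\<close>)
    also have "\<dots> \<le> exp (- (2 * \<eta>) * t) * (lambda_max P * (norm (g 0))\<^sup>2)"
      using V_bounds(2)[of "g 0"] by simp
    finally have "lambda_min P * (norm (g t))\<^sup>2 \<le>
        exp (- (2 * \<eta>) * t) * (lambda_max P * (norm (g 0))\<^sup>2)"
      using V_bounds(1)[of "g t"] by simp
    moreover have "exp (- (2 * \<eta>) * t) = (exp (- \<eta> * t))\<^sup>2"
      by (simp flip: exp_double)
    ultimately have "(norm (g t))\<^sup>2 \<le> (?\<kappa> * exp (- \<eta> * t) * norm (g 0))\<^sup>2"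
      using lam by (simp add: power_mult_distrib field_simps)
    then show ?thesis
      by (rule power2_le_imp_le) (use lam in simp)
  qed

  have f0: "?f 0 = 0"
  proof -
    have "sat ubar 0 = 0"
      by (simp add: sat_def vec_eq_iff)
    then show ?thesis
      by (simp add: avg_field_def dead_zone_def)
  qed
  \<comment> \<open>This ball inside the unit sublevel set serves twice: as the domain of initial
    values for local stability, and to show that 0 is interior to \<open>\<E>\<close>.\<close>
  have small: "V x < 1" if "norm x < 1 / sqrt (lambda_max P)" for x
  proof -
    have "(norm x)\<^sup>2 < (1 / sqrt (lambda_max P))\<^sup>2"
      using that by (intro power_strict_mono) auto
    then have "lambda_max P * (norm x)\<^sup>2 < 1"
      using lam by (simp add: power_divide field_simps)
    then show ?thesis
      using V_bounds(2)[of x] by linarith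
  qed
  have stable: "origin_exp_stable ?f"
    unfolding origin_exp_stable_def
  proof (intro conjI f0 exI allI impI ballI)
    show "norm (g t) \<le> ?\<kappa> * exp (- \<eta> * t) * norm (g 0)"
      if "trajectory_on ?f J g \<and> norm (g 0) < 1 / sqrt (lambda_max P)" "t \<in> J" for J g t
      using that small[of "g 0"] by (intro bound) auto
  qed (use lam \<open>\<eta> > 0\<close> in auto)

  have lyap: "exp_lyapunov_on ?f \<E> V"
    unfolding exp_lyapunov_on_def
  \<comment> \<open>The witnesses are the gradient \<open>2 P x\<close>, the power
    \<open>p = 2\<close>, the extreme eigenvalues of \<open>P\<close> as \<open>k1\<close> and
    \<open>k2\<close>, and \<open>k3 = 2 * \<eta> * lambda_min P\<close>.\<close>
  proof (intro conjI exI ballI)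
    have "ball 0 (1 / sqrt (lambda_max P)) \<subseteq> \<E>"
      using small by (auto simp: \<open>\<E> = _\<close> less_imp_le simp del: \<open>V = _\<close>)
    then show "0 \<in> interior \<E>"
      using lam by (meson centre_in_ball interior_maximal open_ball real_sqrt_gt_zero subsetD
          zero_less_divide_1_iff)
    show "continuous_on \<E> (\<lambda>x. 2 *\<^sub>R (P *v x))"
      by (intro continuous_intros matrix_vector_mult_linear_continuous_on)
    show "(V has_derivative (\<lambda>h. (2 *\<^sub>R (P *v x)) \<bullet> h)) (at x)" for x
      using has_derivative_quadratic_form[OF P_sym] by simp
    fix x assume "x \<in> \<E>"
    then have "V x \<le> 1"
      unfolding \<open>\<E> = _\<close> by blast
    show "lambda_min P * norm x powr 2 \<le> V x" "V x \<le> lambda_max P * norm x powr 2"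
      using V_bounds by simp_all
    have "(2 *\<^sub>R (P *v x)) \<bullet> ?f x \<le> - (2 * \<eta>) * V x"
      using \<open>V x \<le> 1\<close> by (rule decrease)
    also have "\<dots> \<le> - (2 * \<eta>) * (lambda_min P * (norm x)\<^sup>2)"
      using V_bounds(1) \<open>\<eta> > 0\<close> by (intro mult_left_mono_neg) auto
    finally show "(2 *\<^sub>R (P *v x)) \<bullet> ?f x \<le> - (2 * \<eta> * lambda_min P) * norm x powr 2"
      by simp
  qed (use lam \<open>\<eta> > 0\<close> in auto)

  have "\<omega> > 0"
    using assms(2) by (simp add: admissible_frequencies_def)
  have rescale: "solves_on ?f J g \<longleftrightarrow>
      solves_on (\<lambda>x. (1 / \<omega>) *\<^sub>R ((H ** K) *v x) - (1 / \<omega>) *\<^sub>R (H *v dead_zone ubar (K *v x)))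
        ((\<lambda>t. \<omega> * t) ` J) (\<lambda>\<tau>. g (\<tau> / \<omega>))" for J g
    using solves_on_rescale_iff[OF \<open>\<omega> > 0\<close>, of ?f J g] by (simp add: avg_field_def scaleR_diff_right)
  show ?thesis
    using inv rescale stable E_G lyap bound unfolding \<open>\<E> = _\<close> by blast
qed

end
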